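(* Let $n\ge3$ and let $k$ be an integer with $1\le k<n/2$. Put $h=\gcd(k,n)$, $\bar k=k/h$, $\bar n=n/h$, and let $m\in\mathbb{N}$ be a modular inverse of $\bar k$, i.e. $m\bar k\equiv1\pmod{\bar n}$. Consider the representation of $D_n\times O(2)$ on $(z_1,z_2)\in\mathbb{C}^2$ (denoted $e_k\oplus e_{n-k}$) generated by $$\rho(\zeta)(z_1,z_2)=(e^{2\pi ik/n}z_1,e^{-2\pi ik/n}z_2),\quad \rho(\kappa)(z_1,z_2)=(z_2,z_1),$$ $$\rho(\varphi)(z_1,z_2)=e^{i\varphi}(z_1,z_2),\quad \rho(\bar\kappa)(z_1,z_2)=(\bar z_2,\bar z_1).$$ Up to conjugacy, this representation has exactly three isotropy groups with fixed point spaces of real dimension equal to one. They are the isotropy groups of the following points (with $r\in\mathbb{R}$, $r\neq0$), with the following generators: - for any $\bar n$: the point $(r,0)$, with $T_k=\langle(\zeta,-2\pi k/n),(\kappa,\bar\kappa),(\zeta^{\bar n},0)\rangle$; - for $\bar n$ odd: the point $(r,r)$, with $S_k=\langle(\kappa,0),(0,\bar\kappa),(\zeta^{\bar n},0)\rangle$, and the point $(r,-r)$, with $\widetilde S_k=\langle(\kappa,\pi),(0,\pi\bar\kappa),(\zeta^{\bar n},0)\rangle$; - for $\bar n$ even: the point $(r,r)$, with $S_k=\langle(\kappa,0),(0,\bar\kappa),(\zeta^{m\bar n/2},\pi),(\zeta^{\bar n},0)\rangle$, and the point $(r,re^{2\pi i/\bar n})$, with $\widetilde S_k=\langle(\kappa\zeta^{m},0),(0,(2\pi/\bar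 n)\bar\kappa),(\zeta^{m\bar n/2},\pi),(\zeta^{\bar n},0)\rangle$. Furthermore, the Weyl group of each of these isotropy groups contains the (class of the) element $\pi\in S^1\subset O(2)$, which acts on the corresponding fixed point space as multiplication by $-1$.
   Context: $D_n$ is the dihedral group generated by $\zeta$ (of order $n$) and $\kappa$ (of order 2) with $\kappa\zeta\kappa=\zeta^{-1}$. $O(2)$ is generated by the rotations $\varphi\in S^1=\mathbb{R}/2\pi\mathbb{Z}$ and a reflection $\bar\kappa$ with $\bar\kappa\varphi\bar\kappa=-\varphi$. An element of $D_n\times O(2)$ is written $(\gamma,g)$; in either entry $0$ denotes the identity, and $\varphi\bar\kappa$ denotes the product with $\rho(\varphi\bar\kappa)=\rho(\varphi)\rho(\bar\kappa)$; likewise $\rho(\kappa\zeta^m)=\rho(\kappa)\rho(\zeta)^m$. The isotropy group of a point $z$ is $\{g:\rho(g)z=z\}$; the fixed point space of a subgroup $H$ is $\mathrm{Fix}(H)=\{z:\rho(g)z=z\ \forall g\in H\}$; the Weyl group of $H$ is $N(H)/H$ with $N(H)$ the normalizer of $H$. *)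

theory Defs
  imports
    "HOL-Analysis.Analysis"
    "HOL-Algebra.Group_Action"
    "HOL-Algebra.Generated_Groups"
    "HOL-Algebra.Multiplicative_Group"
    "HOL-Number_Theory.Cong"
begin

text \<open>The pair \<open>(a, b)\<close> stands for \<open>\<zeta>\<^sup>a \<kappa>\<^sup>b\<close>; multiplication is dictated by
  \<open>\<kappa> \<zeta>\<^sup>c = \<zeta>\<^sup>-\<^sup>c \<kappa>\<close>. For \<open>c < n\<close> the truncated subtraction \<open>n - c\<close> is exact.\<close>

definition dihedral :: "nat \<Rightarrow> (nat \<times> bool) monoid" where
  "dihedral n =
    \<lparr>carrier = {..<n} \<times> UNIV,
     mult = (\<lambda>(a, b) (c, d). ((a + (if b then n - c else c)) mod n, b \<noteq> d)),
     one = (0, False)\<rparr>"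

definition zeta :: "nat \<times> bool" where
  "zeta = (1, False)"

definition kappa :: "nat \<times> bool" where
  "kappa = (0, True)"

definition O2 :: "(real^2^2) monoid" where
  "O2 = \<lparr>carrier = {A. orthogonal_matrix A}, mult = (**), one = mat 1\<rparr>"

definition rot :: "real \<Rightarrow> real^2^2" where
  "rot \<phi> = vector [vector [cos \<phi>, - sin \<phi>], vector [sin \<phi>, cos \<phi>]]"

definition refl2 :: "real^2^2" where
  "refl2 = vector [vector [1, 0], vector [0, -1]]"

abbreviation DO :: "nat \<Rightarrow> ((nat \<times> bool) \<times> (real^2^2)) monoid" where
  "DO n \<equiv> dihedral n \<times>\<times> O2"

fun rep_zeta :: "nat \<Rightarrow> nat \<Rightarrow> complex \<times> complex \<Rightarrow> complex \<times> complex" where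
  "rep_zeta n k (z1, z2) =
     (cis (2 * pi * real k / real n) * z1, cis (- (2 * pi * real k / real n)) * z2)"

fun rep_kappa :: "complex \<times> complex \<Rightarrow> complex \<times> complex" where
  "rep_kappa (z1, z2) = (z2, z1)"

fun rep_rot :: "real \<Rightarrow> complex \<times> complex \<Rightarrow> complex \<times> complex" where
  "rep_rot \<phi> (z1, z2) = (cis \<phi> * z1, cis \<phi> * z2)"

fun rep_refl :: "complex \<times> complex \<Rightarrow> complex \<times> complex" where
  "rep_refl (z1, z2) = (cnj z2, cnj z1)"

text \<open>An orthogonal matrix \<open>A\<close> is \<open>rot \<phi>\<close> if \<open>det A = 1\<close> and \<open>rot \<phi> ** refl2\<close> otherwise; in both
  cases its first column is \<open>(cos \<phi>, sin \<phi>)\<close>.\<close>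

definition rot_angle :: "real^2^2 \<Rightarrow> real" where
  "rot_angle A = Arg (Complex (A $ 1 $ 1) (A $ 2 $ 1))"

fun rho :: "nat \<Rightarrow> nat \<Rightarrow> (nat \<times> bool) \<times> (real^2^2) \<Rightarrow> complex \<times> complex \<Rightarrow> complex \<times> complex" where
  "rho n k ((a, b), A) =
     (rep_zeta n k ^^ a) \<circ> (if b then rep_kappa else id) \<circ>
     rep_rot (rot_angle A) \<circ> (if det A = 1 then id else rep_refl)"

definition Fix :: "('g \<Rightarrow> 'v \<Rightarrow> 'v) \<Rightarrow> 'g set \<Rightarrow> 'v set" where
  "Fix \<rho> H = {z. \<forall>g\<in>H. \<rho> g z = z}"

definition conjugate_subgroups :: "('g, 'x) monoid_scheme \<Rightarrow> 'g set \<Rightarrow> 'g set \<Rightarrow> bool" where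
  "conjugate_subgroups G H K \<longleftrightarrow> (\<exists>g\<in>carrier G. K = g <#\<^bsub>G\<^esub> H #>\<^bsub>G\<^esub> inv\<^bsub>G\<^esub> g)"

definition axial_isotropy ::
    "('g, 'x) monoid_scheme \<Rightarrow> ('g \<Rightarrow> 'v \<Rightarrow> 'v::real_vector) \<Rightarrow> 'g set set" where
  "axial_isotropy G \<rho> = {H. (\<exists>z. H = stabilizer G \<rho> z) \<and> dim (Fix \<rho> H) = 1}"

definition weyl_group :: "('g, 'x) monoid_scheme \<Rightarrow> 'g set \<Rightarrow> 'g set monoid" where
  "weyl_group G H = (G\<lparr>carrier := normalizer G H\<rparr>) Mod H"

definition T_grp :: "nat \<Rightarrow> nat \<Rightarrow> ((nat \<times> bool) \<times> (real^2^2)) set" where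
  "T_grp n k = (let n' = n div gcd k n in
     generate (DO n)
       {(zeta, rot (- (2 * pi * real k / real n))),
        (kappa, refl2),
        (zeta [^]\<^bsub>dihedral n\<^esub> n', \<one>\<^bsub>O2\<^esub>)})"

definition S_grp :: "nat \<Rightarrow> nat \<Rightarrow> nat \<Rightarrow> ((nat \<times> bool) \<times> (real^2^2)) set" where
  "S_grp n k m = (let n' = n div gcd k n in
     if odd n' then
       generate (DO n)
         {(kappa, \<one>\<^bsub>O2\<^esub>),
          (\<one>\<^bsub>dihedral n\<^esub>, refl2),
          (zeta [^]\<^bsub>dihedral n\<^esub> n', \<one>\<^bsub>O2\<^esub>)}
     else
       generate (DO n)
         {(kappa, \<one>\<^bsub>O2\<^esub>),
          (\<one>\<^bsub>dihedral n\<^esub>, refl2),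
          (zeta [^]\<^bsub>dihedral n\<^esub> (m * n' div 2), rot pi),
          (zeta [^]\<^bsub>dihedral n\<^esub> n', \<one>\<^bsub>O2\<^esub>)})"

definition S'_grp :: "nat \<Rightarrow> nat \<Rightarrow> nat \<Rightarrow> ((nat \<times> bool) \<times> (real^2^2)) set" where
  "S'_grp n k m = (let n' = n div gcd k n in
     if odd n' then
       generate (DO n)
         {(kappa, rot pi),
          (\<one>\<^bsub>dihedral n\<^esub>, rot pi \<otimes>\<^bsub>O2\<^esub> refl2),
          (zeta [^]\<^bsub>dihedral n\<^esub> n', \<one>\<^bsub>O2\<^esub>)}
     else
       generate (DO n)
         {(kappa \<otimes>\<^bsub>dihedral n\<^esub> (zeta [^]\<^bsub>dihedral n\<^esub> m), \<one>\<^bsub>O2\<^esub>),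
          (\<one>\<^bsub>dihedral n\<^esub>, rot (2 * pi / real n') \<otimes>\<^bsub>O2\<^esub> refl2),
          (zeta [^]\<^bsub>dihedral n\<^esub> (m * n' div 2), rot pi),
          (zeta [^]\<^bsub>dihedral n\<^esub> n', \<one>\<^bsub>O2\<^esub>)})"

lemma dihedral_group:
  assumes "n \<ge> 1"
  shows "group (dihedral n)"
proof (rule groupI, goal_cases)
  case (1 x y)
  then show ?case using assms by (auto simp: dihedral_def)
next
  case 2
  then show ?case using assms by (auto simp: dihedral_def)
next
  case (3 x y z)
  obtain a b c d e f where xyz: "x = (a, b)" "y = (c, d)" "z = (e, f)"
    by (metis surj_pair)
  have lt: "a < n" "c < n" "e < n"
    using 3 by (auto simp: dihedral_def xyz)
  have "int (((a + (if b then n - c else c)) mod n + (if b \<noteq> d then n - e else e)) mod n)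
      = int ((a + (if b then n - (c + (if d then n - e else e)) mod n
                        else (c + (if d then n - e else e)) mod n)) mod n)"
  proof -
    have nm: "int ((x + (n - y)) mod n) = (int x - int y) mod int n" if "y \<le> n" for x y
    proof -
      have "int ((x + (n - y)) mod n) = (int x - int y + int n) mod int n"
        using that by (simp add: of_nat_mod of_nat_diff algebra_simps)
      then show ?thesis by simp
    qed
    have pm: "int ((x + y) mod n) = (int x + int y) mod int n" for x y
      by (simp add: of_nat_mod)
    have le: "c \<le> n" "e \<le> n" "(c + (n - e)) mod n \<le> n" "(c + e) mod n \<le> n"
      using lt assms by (simp_all add: less_imp_le)
    show ?thesis
      by (cases b; cases d; simp only: if_True if_False simp_thms nm le
            pm[of _ e] pm[of _ c] pm[of a "(c + e) mod n"] pm[of a "(c + (n - e)) mod n"])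
        (simp_all add: mod_simps algebra_simps)
  qed
  then show ?case by (auto simp: dihedral_def xyz)
next
  case (4 x)
  then show ?case by (auto simp: dihedral_def)
next
  case (5 x)
  obtain a b where x: "x = (a, b)" by (cases x)
  have a: "a < n" using 5 by (auto simp: dihedral_def x)
  show ?case
  proof (cases b)
    case True
    then show ?thesis using a by (intro bexI[of _ "(a, True)"]) (auto simp: dihedral_def x)
  next
    case False
    then show ?thesis using a
      by (intro bexI[of _ "((n - a) mod n, False)"]) (auto simp: dihedral_def x mod_simps)
  qed
qed

lemma zeta_pow: "zeta [^]\<^bsub>dihedral n\<^esub> (j::nat) = (if j = 0 then (0, False) else (j mod n, False))"
  by (induction j) (auto simp: dihedral_def zeta_def nat_pow_def mod_simps)

lemma dihedral_relations:
  assumes "n \<ge> 2"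
  shows "zeta \<in> carrier (dihedral n)" "kappa \<in> carrier (dihedral n)"
    "group.ord (dihedral n) zeta = n" "group.ord (dihedral n) kappa = 2"
    "kappa \<otimes>\<^bsub>dihedral n\<^esub> zeta \<otimes>\<^bsub>dihedral n\<^esub> kappa = inv\<^bsub>dihedral n\<^esub> zeta"
    "generate (dihedral n) {zeta, kappa} = carrier (dihedral n)"
proof -
  interpret group "dihedral n" using assms by (intro dihedral_group) auto
  show z: "zeta \<in> carrier (dihedral n)" and k: "kappa \<in> carrier (dihedral n)"
    using assms by (auto simp: dihedral_def zeta_def kappa_def)
  have "zeta [^]\<^bsub>dihedral n\<^esub> j = \<one>\<^bsub>dihedral n\<^esub> \<longleftrightarrow> n dvd j" for j :: nat
    unfolding zeta_pow by (auto simp: dihedral_def)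
  then show "ord zeta = n" using ord_unique[OF z, of n] by blast
  have "kappa [^]\<^bsub>dihedral n\<^esub> j = (0, odd j)" for j :: nat
    by (induction j) (auto simp: dihedral_def kappa_def nat_pow_def)
  then have "kappa [^]\<^bsub>dihedral n\<^esub> j = \<one>\<^bsub>dihedral n\<^esub> \<longleftrightarrow> 2 dvd j" for j :: nat
    by (auto simp: dihedral_def)
  then show "ord kappa = 2" using ord_unique[OF k, of 2] by blast
  have "kappa \<otimes>\<^bsub>dihedral n\<^esub> zeta \<otimes>\<^bsub>dihedral n\<^esub> kappa \<otimes>\<^bsub>dihedral n\<^esub> zeta = \<one>\<^bsub>dihedral n\<^esub>"
  proof -
    have "n + n - Suc 0 = (n - 1) + n" using assms by simp
    then have "(n + n - Suc 0) mod n = n - 1" using assms by (simp only: mod_add_self2) simp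
    then show ?thesis using assms by (auto simp: dihedral_def zeta_def kappa_def)
  qed
  then show "kappa \<otimes>\<^bsub>dihedral n\<^esub> zeta \<otimes>\<^bsub>dihedral n\<^esub> kappa = inv\<^bsub>dihedral n\<^esub> zeta"
    using z k by (intro inv_equality[symmetric]) auto
  show "generate (dihedral n) {zeta, kappa} = carrier (dihedral n)"
  proof
    show "generate (dihedral n) {zeta, kappa} \<subseteq> carrier (dihedral n)"
      using z k by (intro generate_incl) auto
    have zp: "zeta [^]\<^bsub>dihedral n\<^esub> (j::nat) \<in> generate (dihedral n) {zeta, kappa}" for j
      by (induction j) (auto intro: generate.intros)
    have kin: "kappa \<in> generate (dihedral n) {zeta, kappa}"
      by (intro generate.incl) auto
    show "carrier (dihedral n) \<subseteq> generate (dihedral n) {zeta, kappa}"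
    proof
      fix x assume x: "x \<in> carrier (dihedral n)"
      obtain a b where ab: "x = (a, b)" by (cases x)
      have "x = (if b then zeta [^]\<^bsub>dihedral n\<^esub> a \<otimes>\<^bsub>dihedral n\<^esub> kappa else zeta [^]\<^bsub>dihedral n\<^esub> a)"
        using x unfolding zeta_pow by (auto simp: ab dihedral_def kappa_def)
      then show "x \<in> generate (dihedral n) {zeta, kappa}"
        using zp[of a] generate.eng[OF zp[of a] kin] by (auto split: if_splits)
    qed
  qed
qed

lemma O2_group: "group O2"
proof (rule groupI, goal_cases)
  case (5 x)
  then show ?case
    by (intro bexI[of _ "transpose x"]) (auto simp: O2_def orthogonal_matrix_def)
qed (auto simp: O2_def orthogonal_matrix_mul orthogonal_matrix_id matrix_mul_assoc)

lemma mat2_eq_iff: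
  "(A :: real^2^2) = B \<longleftrightarrow> A$1$1 = B$1$1 \<and> A$1$2 = B$1$2 \<and> A$2$1 = B$2$1 \<and> A$2$2 = B$2$2"
  by (auto simp: vec_eq_iff forall_2)

lemma mat2_mult:
  "((A :: real^2^2) ** B) $ i $ j = A$i$1 * B$1$j + A$i$2 * B$2$j"
  by (simp add: matrix_matrix_mult_def sum_2)

lemma rot_nth [simp]:
  "rot \<phi> $ 1 $ 1 = cos \<phi>" "rot \<phi> $ 1 $ 2 = - sin \<phi>" "rot \<phi> $ 2 $ 1 = sin \<phi>" "rot \<phi> $ 2 $ 2 = cos \<phi>"
  by (auto simp: rot_def)

lemma refl2_nth [simp]:
  "refl2 $ 1 $ 1 = 1" "refl2 $ 1 $ 2 = 0" "refl2 $ 2 $ 1 = 0" "refl2 $ 2 $ 2 = -1"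
  by (auto simp: refl2_def)

lemma mat1_nth [simp]:
  "(mat 1 :: real^2^2) $ 1 $ 1 = 1" "(mat 1 :: real^2^2) $ 1 $ 2 = 0"
  "(mat 1 :: real^2^2) $ 2 $ 1 = 0" "(mat 1 :: real^2^2) $ 2 $ 2 = 1"
  by (auto simp: mat_def)

lemma transpose_nth: "transpose A $ i $ j = A $ j $ i"
  by (simp add: transpose_def)

lemma det_rot [simp]: "det (rot \<phi>) = 1" "det (rot \<phi> ** refl2) = -1"
proof -
  have "cos \<phi> * cos \<phi> + sin \<phi> * sin \<phi> = 1"
    by (metis power2_eq_square sin_cos_squared_add2)
  then show "det (rot \<phi>) = 1" "det (rot \<phi> ** refl2) = -1"
    by (auto simp: det_2 mat2_mult algebra_simps)
qed

lemma rot_mult: "rot \<alpha> ** rot \<beta> = rot (\<alpha> + \<beta>)"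
  by (simp add: mat2_eq_iff mat2_mult cos_add sin_add algebra_simps)

lemma rot_refl2_commute: "refl2 ** rot \<alpha> = rot (- \<alpha>) ** refl2"
  by (simp add: mat2_eq_iff mat2_mult)

lemma refl2_refl2: "refl2 ** refl2 = mat 1"
  by (simp add: mat2_eq_iff mat2_mult)

lemma rot_in_O2: "rot \<phi> \<in> carrier O2" and refl2_in_O2: "refl2 \<in> carrier O2"
proof -
  have "cos \<phi> * cos \<phi> + sin \<phi> * sin \<phi> = 1"
    by (metis power2_eq_square sin_cos_squared_add2)
  then show "rot \<phi> \<in> carrier O2"
    by (auto simp: O2_def orthogonal_matrix mat2_eq_iff mat2_mult transpose_nth algebra_simps)
  show "refl2 \<in> carrier O2"
    by (auto simp: O2_def orthogonal_matrix mat2_eq_iff mat2_mult transpose_nth)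
qed

lemma O2_cases:
  assumes "A \<in> carrier O2"
  obtains \<phi> where "A = rot \<phi>" | \<phi> where "A = rot \<phi> ** refl2"
proof -
  have "transpose A ** A = mat 1" using assms by (simp add: O2_def orthogonal_matrix)
  then have e: "A$1$1 * A$1$1 + A$2$1 * A$2$1 = 1" "A$1$1 * A$1$2 + A$2$1 * A$2$2 = 0"
      "A$1$2 * A$1$2 + A$2$2 * A$2$2 = 1"
    by (auto simp: mat2_eq_iff mat2_mult transpose_nth)
  obtain \<phi> where \<phi>: "A$1$1 = cos \<phi>" "A$2$1 = sin \<phi>"
    using e(1) sincos_total_2pi[of "A$1$1" "A$2$1"] by (metis power2_eq_square)
  define D where "D = A$1$1 * A$2$2 - A$1$2 * A$2$1"
  have DD: "D = 1 \<or> D = -1"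
    using assms det_orthogonal_matrix[of A] by (auto simp: O2_def D_def det_2)
  have "A$2$2 = (A$1$1 * A$1$1 + A$2$1 * A$2$1) * A$2$2" using e by simp
  also have "\<dots> = A$1$1 * D + A$2$1 * (A$1$1 * A$1$2 + A$2$1 * A$2$2)"
    by (simp add: D_def algebra_simps)
  finally have 22: "A$2$2 = D * A$1$1" using e by simp
  have "A$1$2 = (A$1$1 * A$1$1 + A$2$1 * A$2$1) * A$1$2" using e by simp
  also have "\<dots> = - A$2$1 * D + A$1$1 * (A$1$1 * A$1$2 + A$2$1 * A$2$2)"
    by (simp add: D_def algebra_simps)
  finally have 12: "A$1$2 = - D * A$2$1" using e by simp
  show ?thesis
    using DD
  proof
    assume "D = 1"
    then have "A = rot \<phi>" using 22 12 \<phi> by (simp add: mat2_eq_iff)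
    then show ?thesis using that by blast
  next
    assume "D = -1"
    then have "A = rot \<phi> ** refl2" using 22 12 \<phi> by (simp add: mat2_eq_iff mat2_mult)
    then show ?thesis using that by blast
  qed
qed

lemma rep_rot_angle:
  "rep_rot (rot_angle (rot \<phi>)) = rep_rot \<phi>" "rep_rot (rot_angle (rot \<phi> ** refl2)) = rep_rot \<phi>"
proof -
  have "cis (Arg (Complex (cos \<phi>) (sin \<phi>))) = cis \<phi>"
    by (metis cis.code cis_Arg cis_neq_zero norm_cis scaleR_one sgn_div_norm div_by_1 inverse_1)
  then show "rep_rot (rot_angle (rot \<phi>)) = rep_rot \<phi>" 
     "rep_rot (rot_angle (rot \<phi> ** refl2)) = rep_rot \<phi>"
    by (auto simp: rot_angle_def mat2_mult fun_eq_iff)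
qed

lemma rep_zeta_pow:
  "(rep_zeta n k ^^ a) (z1, z2) =
     (cis (2 * pi * real k / real n) ^ a * z1, cis (- (2 * pi * real k / real n)) ^ a * z2)"
  by (induction a) (auto simp: mult_ac)

lemma rho_rot: "rho n k (x, rot \<phi>) = rho n k (x, mat 1) \<circ> rep_rot \<phi>"
  and rho_rot_refl: "rho n k (x, rot \<phi> ** refl2) = rho n k (x, mat 1) \<circ> rep_rot \<phi> \<circ> rep_refl"
proof -
  have "mat 1 = rot 0" by (simp add: mat2_eq_iff)
  moreover have "rep_rot 0 = id" by (auto simp: fun_eq_iff)
  ultimately show "rho n k (x, rot \<phi>) = rho n k (x, mat 1) \<circ> rep_rot \<phi>"
    "rho n k (x, rot \<phi> ** refl2) = rho n k (x, mat 1) \<circ> rep_rot \<phi> \<circ> rep_refl"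
    by (cases x; simp add: rep_rot_angle o_assoc)+
qed

lemma rho_mat1:
  "rho n k ((a, b), mat 1) = (rep_zeta n k ^^ a) \<circ> (if b then rep_kappa else id)"
proof -
  have "mat 1 = rot 0" by (simp add: mat2_eq_iff)
  moreover have "rep_rot 0 = id" by (auto simp: fun_eq_iff)
  ultimately show ?thesis by (simp add: rep_rot_angle o_assoc)
qed

lemma rho_generators:
  shows "rho n k (zeta, \<one>\<^bsub>O2\<^esub>) (z1, z2) =
      (exp (2 * pi * \<i> * k / n) * z1, exp (- (2 * pi * \<i> * k / n)) * z2)"
    and "rho n k (kappa, \<one>\<^bsub>O2\<^esub>) (z1, z2) = (z2, z1)"
    and "rho n k (\<one>\<^bsub>dihedral n\<^esub>, rot \<phi>) (z1, z2) = (exp (\<i> * \<phi>) * z1, exp (\<i> * \<phi>) * z2)"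
    and "rho n k (\<one>\<^bsub>dihedral n\<^esub>, refl2) (z1, z2) = (cnj z2, cnj z1)"
proof -
  have 1: "\<one>\<^bsub>O2\<^esub> = mat 1" "\<one>\<^bsub>dihedral n\<^esub> = (0, False)" by (auto simp: O2_def dihedral_def)
  have r: "refl2 = rot 0 ** refl2" by (simp add: mat2_eq_iff mat2_mult)
  show "rho n k (zeta, \<one>\<^bsub>O2\<^esub>) (z1, z2) =
      (exp (2 * pi * \<i> * k / n) * z1, exp (- (2 * pi * \<i> * k / n)) * z2)"
    by (simp add: 1 zeta_def rho_mat1 cis_conv_exp mult_ac del: rho.simps)
  show "rho n k (kappa, \<one>\<^bsub>O2\<^esub>) (z1, z2) = (z2, z1)"
    by (simp add: 1 kappa_def rho_mat1 del: rho.simps)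
  show "rho n k (\<one>\<^bsub>dihedral n\<^esub>, rot \<phi>) (z1, z2) = (exp (\<i> * \<phi>) * z1, exp (\<i> * \<phi>) * z2)"
    by (simp add: 1 rho_rot rho_mat1 cis_conv_exp del: rho.simps)
  show "rho n k (\<one>\<^bsub>dihedral n\<^esub>, refl2) (z1, z2) = (cnj z2, cnj z1)"
    by (subst r, subst 1) (simp add: rho_rot_refl rho_mat1 del: rho.simps)
qed

lemma rho_linear: "linear (rho n k g)"
proof -
  have z: "linear (rep_zeta n k)" and k: "linear rep_kappa" and r: "linear (rep_rot \<phi>)"
    and c: "linear rep_refl" for \<phi>
    by (auto intro!: linearI simp: algebra_simps)
  have "linear (rep_zeta n k ^^ a)" for a
  proof (induction a)
    case (Suc a)
    then show ?case using linear_compose[OF Suc z] by (simp only: funpow.simps)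
  qed (simp add: linear_id[unfolded id_def] id_def)
  then show ?thesis
    by (cases g; cases "fst g") (auto intro!: linear_compose k r c simp: linear_id)
qed

lemma rho_mult:
  assumes "n \<ge> 1" "g \<in> carrier (DO n)" "h \<in> carrier (DO n)"
  shows "rho n k (g \<otimes>\<^bsub>DO n\<^esub> h) = rho n k g \<circ> rho n k h"
proof -
  obtain a b A c d B where gh: "g = ((a, b), A)" "h = ((c, d), B)"
    by (metis surj_pair)
  have ac: "a < n" "c < n" and AB: "A \<in> carrier O2" "B \<in> carrier O2"
    using assms by (auto simp: gh dihedral_def)
  define w where "w = cis (2 * pi * real k / real n)"
  have w: "w \<noteq> 0" "cis (- (2 * pi * real k / real n)) = inverse w"
    by (auto simp: w_def cis_inverse)
  have "w ^ n = cis (2 * pi * real k)"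
  proof -
    have "real n * (2 * pi * real k / real n) = 2 * pi * real k" using assms(1) by simp
    then show ?thesis by (simp only: w_def Complex.DeMoivre)
  qed
  also have "\<dots> = 1"
    by (simp add: cis_multiple_2pi)
  finally have wn: "w ^ n = 1" .
  have wmod: "w ^ (j mod n) = w ^ j" for j
  proof -
    have "w ^ j = w ^ (n * (j div n) + j mod n)" by simp
    also have "\<dots> = w ^ (j mod n)" by (simp only: power_add power_mult wn) simp
    finally show ?thesis by simp
  qed
  have wneg: "w ^ (n - c) = inverse (w ^ c)"
    using wn ac w by (metis less_imp_le power_diff divide_inverse mult_1)
  define P where "P x = rho n k (x, mat 1)" for x
  have P: "P (j, s) (z1, z2) = (if s then (w ^ j * z2, inverse (w ^ j) * z1)
                                 else (w ^ j * z1, inverse (w ^ j) * z2))" for j s z1 z2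
    by (auto simp: P_def rho_mat1 rep_zeta_pow w(2) w_def[symmetric] power_inverse simp del: rho.simps)
  have cw: "cnj w = inverse w" by (simp add: w_def cis_cnj cis_inverse)
  have Pmult: "P ((a, b) \<otimes>\<^bsub>dihedral n\<^esub> (c, d)) = P (a, b) \<circ> P (c, d)"
    by (auto simp: fun_eq_iff dihedral_def P wmod wneg power_add w(1))
  have Prot: "rep_rot \<phi> \<circ> P x = P x \<circ> rep_rot \<phi>" for \<phi> x
    by (cases x) (auto simp: fun_eq_iff P)
  have Prefl: "rep_refl \<circ> P x = P x \<circ> rep_refl" for x
    by (cases x) (auto simp: fun_eq_iff P cw power_inverse)
  have rr: "rep_rot \<phi> \<circ> rep_rot \<psi> = rep_rot (\<phi> + \<psi>)" for \<phi> \<psi>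
    by (auto simp: fun_eq_iff cis_mult[symmetric])
  have cr: "rep_refl \<circ> rep_rot \<phi> = rep_rot (- \<phi>) \<circ> rep_refl" for \<phi>
    by (auto simp: fun_eq_iff cis_cnj)
  have cc: "rep_refl \<circ> rep_refl = id" by (auto simp: fun_eq_iff)
  define Q where "Q s = (if s then rep_refl else id)" for s
  define R where "R s = (if s then refl2 else mat 1)" for s
  have form: "\<exists>\<phi> s. X = rot \<phi> ** R s" if "X \<in> carrier O2" for X
    using O2_cases[OF that] by (metis R_def matrix_mul_rid)
  have rho: "rho n k (x, rot \<phi> ** R s) = P x \<circ> rep_rot \<phi> \<circ> Q s" for x \<phi> s
    by (cases s) (auto simp: R_def Q_def P_def rho_rot rho_rot_refl simp del: rho.simps)
  obtain \<phi> s where A: "A = rot \<phi> ** R s" using form AB by blast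
  obtain \<psi> t where B: "B = rot \<psi> ** R t" using form AB by blast
  have "A ** B = rot (\<phi> + (if s then - \<psi> else \<psi>)) ** R (s \<noteq> t)"
    unfolding A B R_def
    by (auto simp: mat2_eq_iff mat2_mult cos_add sin_add cos_diff sin_diff algebra_simps)
  then have "rho n k (g \<otimes>\<^bsub>DO n\<^esub> h) =
      P (a, b) \<circ> P (c, d) \<circ> rep_rot (\<phi> + (if s then - \<psi> else \<psi>)) \<circ> Q (s \<noteq> t)"
    by (simp add: gh rho Pmult del: rho.simps) (simp add: O2_def rho Pmult del: rho.simps)
  also have "\<dots> = (P (a, b) \<circ> rep_rot \<phi> \<circ> Q s) \<circ> (P (c, d) \<circ> rep_rot \<psi> \<circ> Q t)"
  proof (rule ext)
    fix z
    note pw = Prot[unfolded fun_eq_iff o_def, rule_format] Prefl[unfolded fun_eq_iff o_def, rule_format]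
      rr[unfolded fun_eq_iff o_def, rule_format] cr[unfolded fun_eq_iff o_def, rule_format]
      cc[unfolded fun_eq_iff o_def id_def, rule_format]
    show "(P (a, b) \<circ> P (c, d) \<circ> rep_rot (\<phi> + (if s then - \<psi> else \<psi>)) \<circ> Q (s \<noteq> t)) z =
        ((P (a, b) \<circ> rep_rot \<phi> \<circ> Q s) \<circ> (P (c, d) \<circ> rep_rot \<psi> \<circ> Q t)) z"
      by (cases s; cases t) (simp_all add: Q_def pw)
  qed
  also have "\<dots> = rho n k g \<circ> rho n k h"
    by (simp add: gh A B rho del: rho.simps)
  finally show ?thesis .
qed

lemma rho_group_action:
  assumes "n \<ge> 1"
  shows "group_action (DO n) UNIV (rho n k)"
proof -
  interpret group "DO n"
    using assms by (intro DirProd_group dihedral_group O2_group)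
  have one: "rho n k \<one>\<^bsub>DO n\<^esub> = id"
    by (auto simp: O2_def dihedral_def rho_mat1 simp del: rho.simps)
  have bij: "rho n k g \<in> Bij UNIV" if g: "g \<in> carrier (DO n)" for g
  proof -
    have "rho n k (inv\<^bsub>DO n\<^esub> g) \<circ> rho n k g = id" "rho n k g \<circ> rho n k (inv\<^bsub>DO n\<^esub> g) = id"
      using g by (simp_all add: rho_mult[OF assms, symmetric] one del: rho.simps mult_DirProd one_DirProd carrier_DirProd)
    then have "bij (rho n k g)" using o_bij by blast
    then show ?thesis by (simp add: Bij_def extensional_def)
  qed
  have "rho n k \<in> hom (DO n) (BijGroup UNIV)"
    by (rule homI) (simp_all add: BijGroup_def bij rho_mult[OF assms] compose_def o_def restrict_def
      del: rho.simps mult_DirProd carrier_DirProd)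
  then show ?thesis
    unfolding group_action_def group_hom_def group_hom_axioms_def
    using group_BijGroup is_group by blast
qed

end

theory Submission
  imports Defs
begin

text \<open>Put \<open>w = e\<^bsup>2\<pi>ik/n\<^esup>\<close>, a primitive \<open>n/gcd(k,n)\<close>-th root of unity. A point with both coordinates
  nonzero can only be axial if the coordinates have equal modulus and the square of their ratio is a
  power of \<open>w\<^sup>2\<close>; otherwise an explicit second direction is fixed by its stabilizer. The group acts on
  such ratios by multiplication with powers of \<open>w\<^sup>2\<close> (and by inversion), so it remains to see that
  the ratios \<open>1\<close> and \<open>q\<close> represent the two classes, where \<open>q = -1\<close> for odd and
  \<open>q = w\<^sup>m\<close> for even \<open>n/gcd(k,n)\<close>.\<close>

declare rho.simps [simp del]

section \<open>Conjugates, normalizers and stabilizers in general groups\<close>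

lemma (in group) mem_conjugate_iff:
  assumes "H \<subseteq> carrier G" "g \<in> carrier G"
  shows "y \<in> g <# H #> inv g \<longleftrightarrow> y \<in> carrier G \<and> inv g \<otimes> y \<otimes> g \<in> H"
proof -
  have c: "inv g \<otimes> (g \<otimes> x) = x" "g \<otimes> (inv g \<otimes> x) = x" if "x \<in> carrier G" for x
    using assms(2) that by (simp_all flip: m_assoc)
  show ?thesis
  proof
    assume "y \<in> g <# H #> inv g"
    then obtain h where h: "h \<in> H" "y = g \<otimes> h \<otimes> inv g"
      by (auto simp: l_coset_def r_coset_def)
    moreover have "h \<in> carrier G" using h assms by auto
    ultimately show "y \<in> carrier G \<and> inv g \<otimes> y \<otimes> g \<in> H"
      using assms by (simp add: m_assoc c)
  next
    assume y: "y \<in> carrier G \<and> inv g \<otimes> y \<otimes> g \<in> H"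
    have "y = g \<otimes> (inv g \<otimes> y \<otimes> g) \<otimes> inv g"
      using assms y by (simp add: m_assoc c)
    then show "y \<in> g <# H #> inv g"
      using y unfolding l_coset_def r_coset_def by blast
  qed
qed

text \<open>Multiplying \<open>g\<close> by a known element of \<open>K\<close> can replace it by a
  simpler element; the stabilizer computations remove reflections and \<open>kappa\<close> in this
  way.\<close>

lemma (in group) subgroup_cancel_right:
  assumes "subgroup K G" "g \<in> carrier G" "x \<in> K" "g \<otimes> x \<in> K"
  shows "g \<in> K"
proof -
  have x: "x \<in> carrier G" by (rule subgroup.mem_carrier[OF assms(1,3)])
  have "g = g \<otimes> x \<otimes> inv x" using assms x by (simp add: m_assoc)
  then show ?thesis
    using subgroup.m_closed[OF assms(1,4) subgroup.m_inv_closed[OF assms(1,3)]] by simp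
qed

lemma (in group) nat_pow_mem_subgroup:
  assumes "subgroup K G" "x \<in> K"
  shows "x [^] (j::nat) \<in> K"
  by (induction j) (simp_all add: subgroup.one_closed[OF assms(1)] subgroup.m_closed[OF assms(1) _ assms(2)])

lemma (in group) central_in_normalizer:
  assumes "subgroup H G" "c \<in> carrier G" "\<And>x. x \<in> carrier G \<Longrightarrow> c \<otimes> x = x \<otimes> c"
  shows "c \<in> normalizer G H"
proof -
  have H: "H \<subseteq> carrier G" by (rule subgroup.subset[OF assms(1)])
  have "inv c \<otimes> x \<otimes> c = x" if "x \<in> carrier G" for x
  proof -
    have "inv c \<otimes> (x \<otimes> c) = x"
      using assms(2) that by (simp flip: assms(3) add: inv_solve_left')
    then show ?thesis using assms(2) that by (simp add: m_assoc)
  qed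
  then have "c <# H #> inv c = H"
    using H by (auto simp: mem_conjugate_iff[OF H assms(2)])
  then show ?thesis using assms(2) H by (simp add: normalizer_def stabilizer_def)
qed

lemma (in group_action) stabilizer_translate:
  assumes "g \<in> carrier G" "x \<in> E"
  shows "stabilizer G \<phi> (\<phi> g x) = g <# stabilizer G \<phi> x #> inv g"
proof -
  interpret group G using group_hom group_hom.axioms(1) by auto
  have gx: "\<phi> g x \<in> E" using assms by (rule element_image) simp
  note im = element_image[OF _ _ refl]
  have "\<phi> y (\<phi> g x) = \<phi> g x \<longleftrightarrow> \<phi> (inv g \<otimes> y \<otimes> g) x = x" if y: "y \<in> carrier G" for y
  proof -
    have e: "\<phi> (inv g \<otimes> y \<otimes> g) x = \<phi> (inv g) (\<phi> y (\<phi> g x))"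
      using assms y gx by (simp add: composition_rule im m_assoc)
    show ?thesis
    proof
      assume "\<phi> y (\<phi> g x) = \<phi> g x"
      then show "\<phi> (inv g \<otimes> y \<otimes> g) x = x"
        using e orbit_sym_aux[OF assms refl] by simp
    next
      assume "\<phi> (inv g \<otimes> y \<otimes> g) x = x"
      then have "\<phi> (inv g) (\<phi> y (\<phi> g x)) = x" using e by simp
      then show "\<phi> y (\<phi> g x) = \<phi> g x"
        using orbit_sym_aux[of "inv g" "\<phi> y (\<phi> g x)" x] assms y gx
        by (simp add: im)
    qed
  qed
  then show ?thesis
    using assms
    by (auto simp: mem_conjugate_iff[OF stabilizer_subset assms(1)])
      (auto simp: stabilizer_def)
qed

lemma dim_1_subset_span:
  fixes z :: "'a::euclidean_space"
  assumes "dim S = 1" "z \<in> S" "z \<noteq> 0"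
  shows "S \<subseteq> span {z}"
  by (rule card_ge_dim_independent) (use assms in auto)

section \<open>Normal forms in O(2) and in the dihedral group\<close>

lemma rot_eqI: "cis \<phi> = cis \<psi> \<Longrightarrow> rot \<phi> = rot \<psi>"
  by (simp add: mat2_eq_iff cis.ctr complex_eq_iff)

text \<open>Writing the identity and \<open>refl2\<close> with angle 0 leaves only the shapes
  \<open>rot \<phi>\<close> and \<open>rot \<phi> ** refl2\<close>, the two that
  \<open>rho_apply\<close> evaluates.\<close>

lemma mat_1_eq_rot: "mat 1 = rot 0"
  by (simp add: mat2_eq_iff)

lemma refl2_eq_rot_refl2: "refl2 = rot 0 ** refl2"
  by (simp add: mat2_eq_iff mat2_mult)

lemma O2_simps [simp]: "\<one>\<^bsub>O2\<^esub> = rot 0" "A \<otimes>\<^bsub>O2\<^esub> B = A ** B"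
  by (simp_all add: O2_def mat_1_eq_rot)

lemma dihedral_simps [simp]:
  "\<one>\<^bsub>dihedral n\<^esub> = (0, False)"
  "(a, False) \<otimes>\<^bsub>dihedral n\<^esub> (c, d) = ((a + c) mod n, d)"
  "(a, True) \<otimes>\<^bsub>dihedral n\<^esub> (c, d) = ((a + (n - c)) mod n, \<not> d)"
  "(a, b) \<in> carrier (dihedral n) \<longleftrightarrow> a < n"
  by (auto simp: dihedral_def)

lemma rot_refl_mult: "(rot \<alpha> ** refl2) ** (rot \<beta> ** refl2) = rot (\<alpha> - \<beta>)"
  by (simp add: mat2_eq_iff mat2_mult cos_diff sin_diff algebra_simps)

lemma rot_refl2_in_O2: "rot \<phi> ** refl2 \<in> carrier O2"
  using group.is_monoid[OF O2_group] monoid.m_closed[of O2] rot_in_O2 refl2_in_O2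
  by (metis O2_simps(2))

lemma zeta_power: "n \<ge> 1 \<Longrightarrow> zeta [^]\<^bsub>dihedral n\<^esub> (j::nat) = (j mod n, False)"
  by (simp add: zeta_pow)

lemma DO_carrier_cases:
  assumes "g \<in> carrier (DO n)"
  obtains (rot) a b \<phi> where "a < n" "g = ((a, b), rot \<phi>)"
  | (refl) a b \<phi> where "a < n" "g = ((a, b), rot \<phi> ** refl2)"
proof -
  obtain a b A where g: "g = ((a, b), A)" by (metis surj_pair)
  with assms have "a < n" "A \<in> carrier O2" by auto
  then show ?thesis using O2_cases[of A] that g by metis
qed

lemma DO_pow:
  "((c, False), rot \<theta>) [^]\<^bsub>DO n\<^esub> (j::nat) =
    ((if j = 0 then 0 else (j * c) mod n, False), rot (real j * \<theta>))"
  by (induction j) (auto simp: rot_mult algebra_simps mod_simps)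

section \<open>The root of unity \<open>w\<close> and its powers\<close>

locale ek_representation =
  fixes n k m :: nat
  assumes n3: "n \<ge> 3" and k1: "1 \<le> k" and k2: "2 * k < n"
    and m_inverse: "[m * (k div gcd k n) = 1] (mod (n div gcd k n))"
begin

definition nb :: nat where "nb = n div gcd k n"

definition w :: complex where "w = cis (2 * pi * real k / real n)"

text \<open>The second coordinate of the third representative point, in the form in which the
  theorem states it; for even \<open>nb\<close>, \<open>q_even\<close> turns it into a power of
  \<open>w\<close>.\<close>

definition q :: complex where "q = (if odd nb then -1 else cis (2 * pi / real nb))"

lemma n1: "n \<ge> 1" and n_pos [simp]: "0 < n"
  using n3 by auto

sublocale group_action "DO n" UNIV "rho n k"
  by (rule rho_group_action[OF n1])

sublocale group "DO n"
  using group_hom group_hom.axioms(1) by auto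

abbreviation stab :: "complex \<times> complex \<Rightarrow> ((nat \<times> bool) \<times> (real^2^2)) set" where
  "stab \<equiv> stabilizer (DO n) (rho n k)"

lemma nb_facts: "n = nb * gcd k n" "nb \<ge> 1" "nb dvd n"
proof -
  show *: "n = nb * gcd k n" by (simp add: nb_def)
  show "nb \<ge> 1" using * n1 by (cases nb) auto
  show "nb dvd n" using * by (metis dvd_triv_left)
qed

lemma w_nz [simp]: "w \<noteq> 0" and norm_w [simp]: "norm w = 1"
  by (auto simp: w_def)

lemma w_power_exp: "w ^ j = exp (2 * of_real pi * \<i> * of_nat (k * j) / of_nat n)"
  unfolding w_def Complex.DeMoivre by (simp add: cis_conv_exp mult_ac)

text \<open>The power is 1 when \<open>n\<close> divides \<open>k * j\<close>; cancelling
  \<open>gcd k n\<close> leaves the factor \<open>k div gcd k n\<close>, which is coprime to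
  \<open>nb\<close>.\<close>

lemma w_power_eq_1_iff: "w ^ j = 1 \<longleftrightarrow> nb dvd j"
proof -
  have "w ^ j = 1 \<longleftrightarrow> n dvd k * j"
    unfolding w_power_exp by (rule complex_root_unity_eq_1[OF n1])
  also have "\<dots> \<longleftrightarrow> nb dvd (k div gcd k n) * j"
  proof -
    have "n dvd k * j \<longleftrightarrow> gcd k n * nb dvd gcd k n * ((k div gcd k n) * j)"
      by (metis nb_facts(1) mult.commute mult.assoc dvd_mult_div_cancel gcd_dvd1)
    then show ?thesis using n1 by simp
  qed
  also have "\<dots> \<longleftrightarrow> nb dvd j"
  proof -
    have "coprime nb (k div gcd k n)"
      unfolding nb_def using n1 by (metis div_gcd_coprime coprime_commute not_one_le_zero)
    then show ?thesis by (simp add: coprime_dvd_mult_right_iff)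
  qed
  finally show ?thesis .
qed

lemma w_power_nb_mult [simp]: "w ^ (nb * j) = 1" "w ^ (j * nb) = 1"
  by (simp_all add: w_power_eq_1_iff)

lemma w_power_mod [simp]: "w ^ (j mod n) = w ^ j"
proof -
  have "w ^ j = w ^ (n * (j div n) + j mod n)" by simp
  also have "\<dots> = w ^ (j mod n)"
    using nb_facts(3) by (simp only: power_add w_power_eq_1_iff[THEN iffD2] dvd_mult2) simp
  finally show ?thesis by simp
qed

text \<open>From \<open>gcd k n \<le> k < n / 2\<close>. In particular
  \<open>w ^ 2 \<noteq> 1\<close>, which makes the fixed space of \<open>T_grp\<close> a
  line.\<close>

lemma nb_ge_3: "nb \<ge> 3"
proof -
  have "k \<ge> gcd k n" using k1 by (simp add: dvd_imp_le)
  then have "2 * gcd k n < nb * gcd k n" using k2 nb_facts(1) by linarith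
  then show ?thesis by simp
qed

text \<open>Exponents of an \<open>nb\<close>-th root of unity matter only modulo \<open>nb\<close>,
  where \<open>m * (k div gcd k n)\<close> is congruent to 1.\<close>

lemma w_power_m: "w ^ m = cis (2 * pi / real nb)"
proof -
  let ?h = "gcd k n"
  have "real (k * m) / real n = real (m * (k div ?h)) / real nb"
  proof -
    have "real k = real ?h * real (k div ?h)" "real n = real ?h * real nb"
      using nb_facts(1) by (metis of_nat_mult dvd_mult_div_cancel gcd_dvd1, metis of_nat_mult mult.commute)
    then show ?thesis using n1 by (simp add: mult.commute)
  qed
  moreover have "w ^ m = cis (2 * pi * (real (k * m) / real n))"
    unfolding w_def Complex.DeMoivre by (simp add: mult_ac)
  ultimately have "w ^ m = cis (2 * pi * (real (m * (k div ?h)) / real nb))" by simp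
  also have "\<dots> = exp (2 * of_real pi * \<i> * of_nat (m * (k div ?h)) / of_nat nb)"
    by (simp add: cis_conv_exp mult_ac)
  also have "\<dots> = exp (2 * of_real pi * \<i> * of_nat 1 / of_nat nb)"
    using m_inverse unfolding nb_def[symmetric] cong_def
    by (rule complex_root_unity_eq[OF nb_facts(2), THEN iffD2])
  finally show ?thesis by (simp add: cis_conv_exp mult_ac)
qed

lemma odd_m: "even nb \<Longrightarrow> odd m"
  using m_inverse unfolding nb_def[symmetric]
  by (metis cong_def cong_dvd_iff dvd_mult2 even_mult_iff odd_one cong_dvd_modulus_nat)

text \<open>The square of this power is 1, but its exponent, an odd multiple of
  \<open>nb div 2\<close>, is not divisible by \<open>nb\<close>.\<close>

lemma w_power_half: "even nb \<Longrightarrow> odd i \<Longrightarrow> w ^ (i * nb div 2) = -1"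
proof -
  assume a: "even nb" "odd i"
  then obtain l where l: "nb = 2 * l" by blast
  with a nb_ge_3 have "\<not> nb dvd i * nb div 2" by simp
  then have "w ^ (i * nb div 2) \<noteq> 1" by (simp add: w_power_eq_1_iff)
  moreover have "(w ^ (i * nb div 2))\<^sup>2 = 1"
    using l by (simp flip: power_mult add: w_power_eq_1_iff)
  ultimately show ?thesis by (simp add: power2_eq_1_iff)
qed

lemma q_even: "even nb \<Longrightarrow> q = w ^ m"
  by (simp add: q_def w_power_m)

lemma norm_q [simp]: "norm q = 1" and q_nz [simp]: "q \<noteq> 0"
  by (auto simp: q_def)

text \<open>This separates the two classes of ratios. For even \<open>nb\<close> the exponent
  \<open>2 * c + m\<close> is odd, hence no multiple of \<open>nb\<close>. For odd
  \<open>nb\<close>, \<open>w ^ (2 * c) = -1\<close> would force \<open>nb dvd 4 * c\<close>, hence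
  \<open>nb dvd c\<close> and \<open>w ^ (2 * c) = 1\<close>.\<close>

lemma q_not_even_power: "w ^ (2 * c) * q \<noteq> 1"
proof
  assume e: "w ^ (2 * c) * q = 1"
  show False
  proof (cases "even nb")
    case True
    then have "w ^ (2 * c + m) = 1" using e by (simp add: q_even power_add)
    then have "nb dvd 2 * c + m" by (simp add: w_power_eq_1_iff)
    then show False using True odd_m by (metis dvd_trans even_add even_mult_iff even_numeral)
  next
    case False
    then have e: "w ^ (2 * c) = -1" using e by (simp add: q_def minus_equation_iff)
    then have "w ^ (4 * c) = 1" using power_mult[of w "2 * c" 2] by (simp add: mult_ac)
    then have "nb dvd 4 * c" by (simp add: w_power_eq_1_iff)
    moreover have "coprime nb 4"
      using False coprime_power_right_iff[of nb 2 2] by simp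
    ultimately have "nb dvd c" by (simp add: coprime_dvd_mult_right_iff)
    then have "w ^ (2 * c) = 1" by (simp add: w_power_eq_1_iff)
    then show False using e by simp
  qed
qed

text \<open>The hypothesis makes \<open>u\<close> plus or minus a power of \<open>w\<close>. For odd
  \<open>nb\<close> every power of \<open>w\<close> is an even one, as 2 is invertible modulo
  \<open>nb\<close>. For even \<open>nb\<close> the sign is itself a power of \<open>w\<close>, and
  modulo \<open>nb\<close> an odd exponent is an even one plus the odd \<open>m\<close>.\<close>

lemma even_power_or_q:
  assumes "u\<^sup>2 * w ^ (2 * a) = 1"
  shows "\<exists>c. u = w ^ (2 * c) \<or> u = w ^ (2 * c) * q"
proof -
  \<comment> \<open>A natural exponent for the inverse of \<open>w ^ a\<close>.\<close>
  define j where "j = a * (nb - 1)"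
  have "a + j = a * nb" using nb_facts(2) by (cases nb) (auto simp: j_def)
  then have wj: "w ^ a * w ^ j = 1" by (simp flip: power_add)
  have "(u * w ^ a)\<^sup>2 = 1"
    using assms by (simp add: power_mult_distrib mult.commute flip: power_mult)
  then have "u * w ^ a = 1 \<or> u * w ^ a = -1" by (simp add: power2_eq_1_iff)
  moreover have "u = (u * w ^ a) * w ^ j" using wj by (simp add: mult.assoc)
  ultimately have u: "u = w ^ j \<or> u = - (w ^ j)" by (metis mult_1 mult_minus1)
  show ?thesis
  proof (cases "even nb")
    case False
    then obtain l where "nb = 2 * l + 1" by (rule oddE)
    then have "2 * (j * ((nb + 1) div 2)) = j * nb + j" by (simp add: algebra_simps)
    then have "w ^ (2 * (j * ((nb + 1) div 2))) = w ^ j" by (simp add: power_add)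
    then show ?thesis using u False
      by (intro exI[of _ "j * ((nb + 1) div 2)"]) (auto simp: q_def)
  next
    case True
    then have "w ^ (nb div 2) = -1" using w_power_half[of 1] by simp
    then have "- (w ^ j) = w ^ (j + nb div 2)" by (simp add: power_add)
    then obtain i where i: "u = w ^ i" using u by auto
    show ?thesis
    proof (cases "even i")
      case True
      then show ?thesis using i by (intro exI[of _ "i div 2"]) simp
    next
      case False
      \<comment> \<open>Adding \<open>m * nb\<close> leaves the power of \<open>w\<close> unchanged
        and keeps the subtraction of \<open>m\<close> exact.\<close>
      have le: "m \<le> m * nb" using nb_facts(2) by simp
      have "even (i + m * nb - m)" using False \<open>even nb\<close> odd_m le by simp
      then have "2 * ((i + m * nb - m) div 2) = i + m * nb - m" by simp
      then have "2 * ((i + m * nb - m) div 2) + m = i + m * nb" using le by linarith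
      then have "w ^ (2 * ((i + m * nb - m) div 2)) * w ^ m = w ^ (i + m * nb)"
        by (metis power_add)
      then have "w ^ (2 * ((i + m * nb - m) div 2)) * q = u"
        using i \<open>even nb\<close> by (simp add: power_add q_even)
      then show ?thesis by metis
    qed
  qed
qed

section \<open>The action in coordinates\<close>

text \<open>Both \<open>kappa\<close> and \<open>refl2\<close> swap the coordinates, so for a
  reflection the swap remains exactly when \<open>b\<close> is false.\<close>

lemma rho_apply:
  "rho n k ((a, b), rot \<phi>) (z1, z2) =
    (w ^ a * cis \<phi> * (if b then z2 else z1), inverse (w ^ a) * cis \<phi> * (if b then z1 else z2))"
  "rho n k ((a, b), rot \<phi> ** refl2) (z1, z2) =
    (w ^ a * cis \<phi> * cnj (if b then z1 else z2), inverse (w ^ a) * cis \<phi> * cnj (if b then z2 else z1))"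
proof -
  have w': "cis (- (2 * pi * real k / real n)) = inverse w"
    by (simp add: w_def cis_inverse)
  show "rho n k ((a, b), rot \<phi>) (z1, z2) =
    (w ^ a * cis \<phi> * (if b then z2 else z1), inverse (w ^ a) * cis \<phi> * (if b then z1 else z2))"
    "rho n k ((a, b), rot \<phi> ** refl2) (z1, z2) =
    (w ^ a * cis \<phi> * cnj (if b then z1 else z2), inverse (w ^ a) * cis \<phi> * cnj (if b then z2 else z1))"
    by (simp_all add: rho_rot rho_rot_refl rho_mat1 rep_zeta_pow w' w_def[symmetric] power_inverse)
qed

lemma mem_stab_iff: "g \<in> stab z \<longleftrightarrow> g \<in> carrier (DO n) \<and> rho n k g z = z"
  by (simp add: stabilizer_def)

lemma rot_in_carrier [simp]:
  "((a, b), rot \<phi>) \<in> carrier (DO n) \<longleftrightarrow> a < n"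
  "((a, b), rot \<phi> ** refl2) \<in> carrier (DO n) \<longleftrightarrow> a < n"
  by (simp_all add: rot_in_O2 rot_refl2_in_O2)

lemma stab_subgroup: "subgroup (stab z) (DO n)"
  by (rule stabilizer_subgroup) simp

lemma stab_scaleR: "r \<noteq> 0 \<Longrightarrow> stab (r *\<^sub>R z) = stab z"
  by (simp add: stabilizer_def linear_cmul[OF rho_linear])

section \<open>Generators of the three stabilizers\<close>

text \<open>The last hypotheses say that the element acts as the identity, so
  \<open>cis \<phi> = w ^ a\<close> has square 1. The value -1 occurs only for even
  \<open>nb\<close>, and multiplying by the element in \<open>K2\<close> reduces it to the value 1.
  The exponent is \<open>nb mod n\<close> because \<open>nb = n\<close> if \<open>k\<close> and
  \<open>n\<close> are coprime.\<close>

lemma kernel_subset: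
  assumes K: "subgroup K (DO n)"
    and K1: "((nb mod n, False), rot 0) \<in> K"
    and K2: "even nb \<Longrightarrow> ((m * nb div 2 mod n, False), rot pi) \<in> K"
    and a: "a < n" and e: "w ^ a * cis \<phi> = 1" "inverse (w ^ a) * cis \<phi> = 1"
  shows "((a, False), rot \<phi>) \<in> K"
proof -
  have base: "((a, False), rot \<phi>) \<in> K" if a: "a < n" "w ^ a = 1" "cis \<phi> = 1" for a \<phi>
  proof -
    have "rot \<phi> = rot 0" using a by (intro rot_eqI) simp
    moreover obtain j where j: "a = nb * j" using a by (auto simp: w_power_eq_1_iff)
    moreover have "((nb mod n, False), rot 0) [^]\<^bsub>DO n\<^esub> j = ((a, False), rot 0)"
      using a j by (simp add: DO_pow mult.commute mod_simps)
    ultimately show ?thesis using nat_pow_mem_subgroup[OF K K1, of j] by simp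
  qed
  have c: "cis \<phi> = w ^ a" using e(2) by (simp add: field_simps)
  then have "(w ^ a)\<^sup>2 = 1" using e(1) by (simp add: power2_eq_square)
  then consider "w ^ a = 1" | "w ^ a = -1" by (auto simp: power2_eq_1_iff)
  then show ?thesis
  proof cases
    case 1
    then show ?thesis using base a c by simp
  next
    case 2
    then have "\<not> nb dvd a" by (auto simp flip: w_power_eq_1_iff)
    moreover have "nb dvd 2 * a"
      using \<open>(w ^ a)\<^sup>2 = 1\<close> by (simp add: mult.commute flip: w_power_eq_1_iff power_mult)
    ultimately have ev: "even nb" by (metis coprime_dvd_mult_right_iff coprime_right_2_iff_odd)
    have "((a, False), rot \<phi>) \<otimes>\<^bsub>DO n\<^esub> ((m * nb div 2 mod n, False), rot pi)
        = (((a + m * nb div 2 mod n) mod n, False), rot (\<phi> + pi))"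
      by (simp add: rot_mult)
    also have "\<dots> \<in> K"
      using 2 c w_power_half[OF ev odd_m[OF ev]]
      by (intro base) (simp_all add: power_add flip: cis_mult)
    finally have *: "((a, False), rot \<phi>) \<otimes>\<^bsub>DO n\<^esub> ((m * nb div 2 mod n, False), rot pi) \<in> K" .
    show ?thesis
      by (rule subgroup_cancel_right[OF K _ K2[OF ev] *]) (use a in \<open>simp del: carrier_DirProd\<close>)
  qed
qed

text \<open>With both coordinates nonzero, a rotation without \<open>kappa\<close> in the stabilizer
  acts as the identity. The element in \<open>K3\<close> removes \<open>kappa\<close> and the one in
  \<open>K4\<close> a reflection, so every element reduces to this case.\<close>

lemma stab_subset:
  assumes K: "subgroup K (DO n)"
    and K1: "((nb mod n, False), rot 0) \<in> K"
    and K2: "even nb \<Longrightarrow> ((m * nb div 2 mod n, False), rot pi) \<in> K"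
    and K3: "((c, True), rot \<alpha>) \<in> K" "((c, True), rot \<alpha>) \<in> stab (z1, z2)"
    and K4: "((0, False), rot \<beta> ** refl2) \<in> K" "((0, False), rot \<beta> ** refl2) \<in> stab (z1, z2)"
    and z: "z1 \<noteq> 0" "z2 \<noteq> 0"
  shows "stab (z1, z2) \<subseteq> K"
proof -
  note stab_mult = subgroup.m_closed[OF stab_subgroup]
  have FF: "((a, False), rot \<phi>) \<in> K" if "((a, False), rot \<phi>) \<in> stab (z1, z2)" for a \<phi>
    using that z by (intro kernel_subset[OF K K1 K2]) (auto simp: mem_stab_iff rho_apply)
  have TF: "((a, True), rot \<phi>) \<in> K" if g: "((a, True), rot \<phi>) \<in> stab (z1, z2)" for a \<phi>
  proof (rule subgroup_cancel_right[OF K _ K3(1)])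
    show "((a, True), rot \<phi>) \<in> carrier (DO n)" using g by (simp add: mem_stab_iff)
    have "((a, True), rot \<phi>) \<otimes>\<^bsub>DO n\<^esub> ((c, True), rot \<alpha>) =
        (((a + (n - c)) mod n, False), rot (\<phi> + \<alpha>))"
      by (simp add: rot_mult)
    then show "((a, True), rot \<phi>) \<otimes>\<^bsub>DO n\<^esub> ((c, True), rot \<alpha>) \<in> K"
      using FF stab_mult[OF g K3(2)] by metis
  qed
  have rotK: "((a, b), rot \<phi>) \<in> K" if "((a, b), rot \<phi>) \<in> stab (z1, z2)" for a b \<phi>
    using that FF TF by (cases b) auto
  show ?thesis
  proof
    fix g assume g: "g \<in> stab (z1, z2)"
    then have gc: "g \<in> carrier (DO n)" by (simp add: mem_stab_iff)
    then show "g \<in> K"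
    proof (cases rule: DO_carrier_cases)
      case (rot a b \<phi>)
      then show ?thesis using rotK g by simp
    next
      case (refl a b \<phi>)
      have "g \<otimes>\<^bsub>DO n\<^esub> ((0, False), rot \<beta> ** refl2) =
          (((if b then a + n else a) mod n, b), rot (\<phi> - \<beta>))"
        using refl by (cases b) (simp_all add: rot_refl_mult)
      then have "g \<otimes>\<^bsub>DO n\<^esub> ((0, False), rot \<beta> ** refl2) \<in> K"
        using rotK stab_mult[OF g K4(2)] by metis
      then show ?thesis by (rule subgroup_cancel_right[OF K gc K4(1)])
    qed
  qed
qed

text \<open>Both elements act as the identity on the whole space: \<open>w ^ nb = 1\<close>, and in
  the second one the power of \<open>zeta\<close> and the rotation each contribute the factor
  -1.\<close>

lemma zeta_in_stab:
  "((nb mod n, False), rot 0) \<in> stab z"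
  "even nb \<Longrightarrow> ((m * nb div 2 mod n, False), rot pi) \<in> stab z"
  using w_power_half[OF _ odd_m] w_power_eq_1_iff[of nb]
  by (cases z; simp add: mem_stab_iff rho_apply del: carrier_DirProd)+

lemma stab_T: "stab (1, 0) = T_grp n k"
proof -
  define t where "t = ((1::nat, False), rot (- (2 * pi * real k / real n)))"
  have gens: "T_grp n k = generate (DO n)
      {t, ((0, True), rot 0 ** refl2), ((nb mod n, False), rot 0)}"
    unfolding T_grp_def Let_def nb_def[symmetric] zeta_power[OF n1] t_def
    by (simp add: zeta_def kappa_def flip: refl2_eq_rot_refl2)
  have w_cis: "cis (- (2 * pi * real k / real n)) = inverse w"
    by (simp add: w_def cis_inverse)
  have "stab (1, 0) = generate (DO n)
      {t, ((0, True), rot 0 ** refl2), ((nb mod n, False), rot 0)}"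
  proof (rule generateI[OF stab_subgroup])
    show "{t, ((0, True), rot 0 ** refl2), ((nb mod n, False), rot 0)} \<subseteq> stab (1, 0)"
      using zeta_in_stab(1)[of "(1, 0)"] n3
      by (simp add: t_def) (simp add: mem_stab_iff rho_apply w_cis del: carrier_DirProd)
  next
    fix K assume K: "subgroup K (DO n)"
      and "{t, ((0, True), rot 0 ** refl2), ((nb mod n, False), rot 0)} \<subseteq> K"
    then have t: "t \<in> K" and r: "((0, True), rot 0 ** refl2) \<in> K" by auto
    \<comment> \<open>The first coordinate alone determines \<open>cis \<phi>\<close> as the inverse
      of \<open>w ^ a\<close>, which makes the element the \<open>a\<close>-th power of
      \<open>t\<close>.\<close>
    have rotK: "((a, False), rot \<phi>) \<in> K" if a: "a < n" "w ^ a * cis \<phi> = 1" for a \<phi>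
    proof -
      have "cis \<phi> = inverse w ^ a" using a(2) by (simp add: field_simps)
      also have "\<dots> = cis (real a * - (2 * pi * real k / real n))"
        by (simp only: w_cis[symmetric] Complex.DeMoivre)
      finally have "rot \<phi> = rot (real a * - (2 * pi * real k / real n))" by (rule rot_eqI)
      then have "t [^]\<^bsub>DO n\<^esub> a = ((a, False), rot \<phi>)"
        using a(1) by (simp add: t_def DO_pow)
      then show ?thesis using nat_pow_mem_subgroup[OF K t, of a] by simp
    qed
    show "stab (1, 0) \<subseteq> K"
    proof
      fix g assume g: "g \<in> stab (1, 0)"
      then have gc: "g \<in> carrier (DO n)" by (simp add: mem_stab_iff)
      then show "g \<in> K"
      proof (cases rule: DO_carrier_cases)
        case (rot a b \<phi>)
        then show ?thesis using g rotK by (auto simp: mem_stab_iff rho_apply split: if_splits)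
      next
        case (refl a b \<phi>)
        \<comment> \<open>A reflection without \<open>kappa\<close> would move \<open>(1, 0)\<close>
          into the second coordinate.\<close>
        then have "b" "w ^ a * cis \<phi> = 1"
          using g by (auto simp: mem_stab_iff rho_apply split: if_splits)
        then have "g \<otimes>\<^bsub>DO n\<^esub> ((0, True), rot 0 ** refl2) \<in> K"
          using refl rotK by (simp add: rot_refl_mult)
        then show ?thesis by (rule subgroup_cancel_right[OF K gc r])
      qed
    qed
  qed
  then show ?thesis using gens by simp
qed

text \<open>Common source of \<open>stab_S\<close> and \<open>stab_S'\<close>, which then only have
  to exhibit one rotation with \<open>kappa\<close> and one reflection without it.\<close>

lemma stab_eq_generate:
  assumes K3: "((c, True), rot \<alpha>) \<in> stab (z1, z2)"
    and K4: "((0, False), rot \<beta> ** refl2) \<in> stab (z1, z2)"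
    and z: "z1 \<noteq> 0" "z2 \<noteq> 0"
  shows "stab (z1, z2) = generate (DO n)
    ({((c, True), rot \<alpha>), ((0, False), rot \<beta> ** refl2), ((nb mod n, False), rot 0)} \<union>
     (if even nb then {((m * nb div 2 mod n, False), rot pi)} else {}))" (is "_ = generate _ ?X")
proof (rule generateI[OF stab_subgroup])
  show "?X \<subseteq> stab (z1, z2)" using assms zeta_in_stab by simp
  fix K assume K: "subgroup K (DO n)" "?X \<subseteq> K"
  then show "stab (z1, z2) \<subseteq> K"
    by (intro stab_subset[OF K(1) _ _ _ K3 _ K4 z]) auto
qed

lemma stab_S: "stab (1, 1) = S_grp n k m"
proof -
  have "((0, True), rot 0) \<in> stab (1, 1)" "((0, False), rot 0 ** refl2) \<in> stab (1, 1)"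
    by (simp_all add: mem_stab_iff rho_apply del: carrier_DirProd)
  from stab_eq_generate[OF this] show ?thesis
    unfolding S_grp_def Let_def nb_def[symmetric] zeta_power[OF n1]
    by (simp add: kappa_def insert_commute flip: refl2_eq_rot_refl2)
qed

text \<open>Data of the first two generators of \<open>S'_grp\<close>, with the power of
  \<open>zeta\<close> on the left: for even \<open>nb\<close>, moving \<open>zeta\<close> to the
  left of \<open>kappa\<close> turns the exponent \<open>m\<close> into \<open>-m\<close>.\<close>

definition S'_shift :: nat where "S'_shift = (if odd nb then 0 else (n - m mod n) mod n)"
definition S'_angle :: real where "S'_angle = (if odd nb then pi else 0)"
definition S'_axis :: real where "S'_axis = (if odd nb then pi else 2 * pi / real nb)"

lemma in_stab_S':
  "((S'_shift, True), rot S'_angle) \<in> stab (1, q)" "((0, False), rot S'_axis ** refl2) \<in> stab (1, q)"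
proof -
  have "w ^ (n - m mod n) * w ^ (m mod n) = w ^ n"
    by (simp del: w_power_mod flip: power_add)
  also have "\<dots> = 1" using nb_facts(3) by (simp add: w_power_eq_1_iff)
  finally have "w ^ (n - m mod n) = inverse (w ^ m)" by (simp add: field_simps)
  then show "((S'_shift, True), rot S'_angle) \<in> stab (1, q)"
    by (simp add: mem_stab_iff rho_apply S'_shift_def S'_angle_def q_def w_power_m cis_mult
        del: carrier_DirProd)
  show "((0, False), rot S'_axis ** refl2) \<in> stab (1, q)"
    by (simp add: mem_stab_iff rho_apply S'_axis_def q_def cis_cnj cis_mult del: carrier_DirProd)
qed

lemma stab_S': "stab (1, q) = S'_grp n k m"
  using stab_eq_generate[OF in_stab_S']
  unfolding S'_grp_def Let_def nb_def[symmetric] zeta_power[OF n1]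
  by (simp add: kappa_def insert_commute S'_shift_def S'_angle_def S'_axis_def)

section \<open>Fixed point spaces\<close>

lemma Fix_stab_eq_span:
  assumes "\<And>v. v \<in> Fix (rho n k) (stab p) \<Longrightarrow> v \<in> span {p}"
  shows "Fix (rho n k) (stab p) = span {p}"
  using assms by (auto simp: span_singleton Fix_def mem_stab_iff linear_cmul[OF rho_linear])

text \<open>The first generator multiplies the second coordinate by the inverse of
  \<open>w ^ 2\<close>, which is not 1; the second one conjugates the first coordinate and so makes
  it real.\<close>

lemma Fix_T: "Fix (rho n k) (stab (1, 0)) = span {(1, 0)}"
proof (rule Fix_stab_eq_span)
  fix v assume v: "v \<in> Fix (rho n k) (stab (1, 0))"
  obtain v1 v2 where v12: "v = (v1, v2)" by (cases v)
  have w_cis: "cis (- (2 * pi * real k / real n)) = inverse w"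
    by (simp add: w_def cis_inverse)
  have "((1, False), rot (- (2 * pi * real k / real n))) \<in> stab (1, 0)"
       "((0, True), rot 0 ** refl2) \<in> stab (1, 0)"
    using n3 by (simp_all add: mem_stab_iff rho_apply w_cis del: carrier_DirProd)
  then have "rho n k ((1, False), rot (- (2 * pi * real k / real n))) v = v"
     "rho n k ((0, True), rot 0 ** refl2) v = v"
    using v by (auto simp: Fix_def)
  then have e: "inverse w * inverse w * v2 = v2" "cnj v1 = v1"
    by (auto simp: v12 rho_apply w_cis)
  have "w ^ 2 \<noteq> 1" using nb_ge_3 by (auto simp: w_power_eq_1_iff dest: dvd_imp_le)
  then have "v2 = 0" using e(1) by (auto simp: power2_eq_square field_simps)
  moreover have "v1 = of_real (Re v1)" using e(2) by (simp add: complex_eq_iff)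
  ultimately show "v \<in> span {(1, 0)}"
    by (auto simp: v12 span_singleton scaleR_conv_of_real)
qed

lemma Fix_S: "Fix (rho n k) (stab (1, 1)) = span {(1, 1)}"
proof (rule Fix_stab_eq_span)
  fix v assume v: "v \<in> Fix (rho n k) (stab (1, 1))"
  obtain v1 v2 where v12: "v = (v1, v2)" by (cases v)
  have "((0, True), rot 0) \<in> stab (1, 1)" "((0, False), rot 0 ** refl2) \<in> stab (1, 1)"
    by (simp_all add: mem_stab_iff rho_apply del: carrier_DirProd)
  then have "fst (rho n k ((0, True), rot 0) v) = fst v"
    "fst (rho n k ((0, False), rot 0 ** refl2) v) = fst v"
    using v by (auto simp: Fix_def)
  then have "v2 = v1" "cnj v2 = v1" by (simp_all add: v12 rho_apply)
  then have "v2 = v1" "Im v1 = 0" by (auto dest: arg_cong[of _ _ Im])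
  then have "v = Re v1 *\<^sub>R (1, 1)" by (simp add: v12 complex_eq_iff)
  then show "v \<in> span {(1, 1)}" by (auto simp: span_singleton)
qed

lemma Fix_S': "Fix (rho n k) (stab (1, q)) = span {(1, q)}"
proof (rule Fix_stab_eq_span)
  fix v assume v: "v \<in> Fix (rho n k) (stab (1, q))"
  obtain v1 v2 where v12: "v = (v1, v2)" by (cases v)
  have fixed: "rho n k ((S'_shift, True), rot S'_angle) v = v"
    "rho n k ((0, False), rot S'_axis ** refl2) v = v"
    using v in_stab_S' by (auto simp: Fix_def)
  \<comment> \<open>The scalar is read off from the fact that the same element fixes
    \<open>(1, q)\<close>, which avoids a split on the parity of \<open>nb\<close>.\<close>
  have "inverse (w ^ S'_shift) * cis S'_angle = q" using in_stab_S'(1) by (simp add: mem_stab_iff rho_apply)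
  then have v2: "v2 = q * v1" using fixed(1) by (simp add: v12 rho_apply)
  have "cis S'_axis = q" using in_stab_S'(2) by (simp add: mem_stab_iff rho_apply)
  then have "q * cnj v2 = v1" using fixed(2) by (simp add: v12 rho_apply)
  moreover have "q * cnj q = 1" by (simp add: complex_norm_square[symmetric])
  ultimately have "cnj v1 = v1" using v2 by (metis complex_cnj_mult mult.assoc mult_1)
  then have "v1 = of_real (Re v1)" by (simp add: complex_eq_iff)
  then show "v \<in> span {(1, q)}"
    using v2 by (auto simp: v12 span_singleton scaleR_conv_of_real mult.commute)
qed

section \<open>The three stabilizers are pairwise not conjugate\<close>

text \<open>A conjugate of \<open>stab p\<close> is the stabilizer of a translate of
  \<open>p\<close>, so this translate lies on the line fixed by \<open>stab p'\<close>.\<close>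

lemma stab_conjugateD:
  assumes "Fix (rho n k) (stab p') = span {p'}" and "conjugate_subgroups (DO n) (stab p) (stab p')"
  shows "\<exists>g\<in>carrier (DO n). \<exists>r. rho n k g p = r *\<^sub>R p'"
proof -
  obtain g where g: "g \<in> carrier (DO n)" and "stab p' = stab (rho n k g p)"
    using assms(2) stabilizer_translate unfolding conjugate_subgroups_def by auto
  then have "rho n k g p \<in> Fix (rho n k) (stab p')" by (simp add: Fix_def mem_stab_iff)
  then show ?thesis using g assms(1) by (auto simp: span_singleton)
qed

text \<open>Group elements map \<open>(1, 0)\<close> to points with exactly one vanishing
  coordinate.\<close>

lemma T_not_conjugate:
  assumes "x \<noteq> 0" "rho n k g (1, 0) = r *\<^sub>R (1, x)" "g \<in> carrier (DO n)"
  shows False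
  using assms(3)
proof (cases rule: DO_carrier_cases)
  case (rot a b \<phi>)
  then show False using assms by (auto simp: rho_apply split: if_splits)
next
  case (refl a b \<phi>)
  then show False using assms by (auto simp: rho_apply split: if_splits)
qed

text \<open>Swaps and conjugations fix \<open>(1, 1)\<close>, so the coordinates of its image have
  as ratio the inverse of an even power of \<open>w\<close>, and this is never
  \<open>q\<close>.\<close>

lemma S_not_conjugate:
  assumes "rho n k g (1, 1) = r *\<^sub>R (1, q)" "g \<in> carrier (DO n)"
  shows False
proof -
  obtain a \<phi> where "w ^ a * cis \<phi> = of_real r" "inverse (w ^ a) * cis \<phi> = of_real r * q"
    using assms(2)
  proof (cases rule: DO_carrier_cases)
    case (rot a b \<phi>)
    then show ?thesis using assms that by (auto simp: rho_apply scaleR_conv_of_real)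
  next
    case (refl a b \<phi>)
    then show ?thesis using assms that by (auto simp: rho_apply scaleR_conv_of_real)
  qed
  then have "inverse (w ^ a) * cis \<phi> = w ^ a * cis \<phi> * q" by simp
  then have "w ^ a * w ^ a * q = 1" by (simp add: field_simps)
  then have "w ^ (2 * a) * q = 1" by (simp add: mult_2 power_add)
  then show False using q_not_even_power by blast
qed

section \<open>Orbits of the axial points\<close>

lemma rotate_to_norm: "cis (- Arg z) * z = of_real (norm z)"
proof -
  have "cis (- Arg z) * z = cis (- Arg z) * (of_real (norm z) * cis (Arg z))"
    using rcis_cmod_Arg[of z] by (simp add: rcis_def)
  also have "\<dots> = of_real (norm z) * (cis (- Arg z) * cis (Arg z))" by (simp only: mult_ac)
  finally show ?thesis by (simp only: cis_mult) simp
qed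

text \<open>If both coordinates are nonzero, \<open>(z1, 0)\<close> and
  \<open>(\<i> * z1, - \<i> * z2)\<close> lie off the real line through \<open>z\<close>, so the
  stabilizer fixes neither. The first fact yields equal moduli, the second restricts the ratio
  \<open>z2 / z1\<close>.\<close>

lemma axial_orbit:
  assumes Fix_subset: "Fix (rho n k) (stab z) \<subseteq> span {z}" and z: "z \<noteq> 0"
  shows "\<exists>g\<in>carrier (DO n). \<exists>r p. r \<noteq> 0 \<and> p \<in> {(1, 0), (1, 1), (1, q)} \<and> rho n k g z = r *\<^sub>R p"
proof -
  obtain z1 z2 where z12: "z = (z1, z2)" by (cases z)
  consider "z2 = 0" "z1 \<noteq> 0" | "z1 = 0" "z2 \<noteq> 0" | "z1 \<noteq> 0" "z2 \<noteq> 0"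
    using z z12 by (auto simp: zero_prod_def)
  then show ?thesis
  proof cases
    case 1
    then show ?thesis
      by (intro bexI[of _ "((0, False), rot (- Arg z1))"] exI[of _ "norm z1"] exI[of _ "(1, 0)"])
        (simp_all add: z12 rho_apply rotate_to_norm scaleR_conv_of_real del: carrier_DirProd)
  next
    case 2
    then show ?thesis
      by (intro bexI[of _ "((0, True), rot (- Arg z2))"] exI[of _ "norm z2"] exI[of _ "(1, 0)"])
        (simp_all add: z12 rho_apply rotate_to_norm scaleR_conv_of_real del: carrier_DirProd)
  next
    case nz: 3
    have notin: "(z1, 0) \<notin> Fix (rho n k) (stab z)"
      using Fix_subset nz by (auto simp: span_singleton z12)
    have notin_i: "(\<i> * z1, - \<i> * z2) \<notin> Fix (rho n k) (stab z)"
    proof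
      assume "(\<i> * z1, - \<i> * z2) \<in> Fix (rho n k) (stab z)"
      then obtain r where "\<i> * z1 = of_real r * z1"
        using Fix_subset by (auto simp: span_singleton z12 scaleR_conv_of_real)
      then have "\<i> = of_real r" using nz by simp
      then show False by (simp add: complex_eq_iff)
    qed
    \<comment> \<open>Otherwise no stabilizing element interchanges the coordinates, so \<open>(z1, 0)\<close> is fixed too.\<close>
    have norm_eq: "norm z1 = norm z2"
    proof (rule ccontr)
      assume ne: "norm z1 \<noteq> norm z2"
      have "rho n k g (z1, 0) = (z1, 0)" if g: "g \<in> stab z" for g
      proof -
        have gc: "g \<in> carrier (DO n)" and gz: "rho n k g (z1, z2) = (z1, z2)"
          using g by (auto simp: mem_stab_iff z12)
        show ?thesis using gc
        proof (cases rule: DO_carrier_cases)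
          case (rot a b \<phi>)
          have "\<not> b"
          proof
            assume b
            then have "z1 = w ^ a * cis \<phi> * z2" using gz rot by (simp add: rho_apply)
            then show False using ne by (simp add: norm_mult norm_power)
          qed
          then show ?thesis using gz rot by (simp add: rho_apply)
        next
          case (refl a b \<phi>)
          have "b"
          proof (rule ccontr)
            assume "\<not> b"
            then have "z1 = w ^ a * cis \<phi> * cnj z2" using gz refl by (simp add: rho_apply)
            then show False using ne by (simp add: norm_mult norm_power)
          qed
          then show ?thesis using gz refl by (simp add: rho_apply)
        qed
      qed
      then show False using notin by (simp add: Fix_def)
    qed
    \<comment> \<open>Otherwise the stabilizer acts through the identity and the single antilinear involution
      fixing \<open>z\<close>, which also fixes \<open>(\<i> z1, -\<i> z2)\<close>.\<close>
    have *: "\<exists>a. (z2 / z1)\<^sup>2 * w ^ (2 * a) = 1"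
    proof (rule ccontr)
      assume no: "\<not> ?thesis"
      have no': "z2 * z2 * (w ^ a * w ^ a) \<noteq> z1 * z1" for a
      proof
        assume "z2 * z2 * (w ^ a * w ^ a) = z1 * z1"
        then have "(z2 / z1)\<^sup>2 * w ^ (2 * a) = 1"
          using nz by (simp add: power_divide power2_eq_square mult_2 power_add)
        then show False using no by blast
      qed
      have "rho n k g (\<i> * z1, - \<i> * z2) = (\<i> * z1, - \<i> * z2)" if g: "g \<in> stab z" for g
      proof -
        have gc: "g \<in> carrier (DO n)" and gz: "rho n k g (z1, z2) = (z1, z2)"
          using g by (auto simp: mem_stab_iff z12)
        show ?thesis using gc
        proof (cases rule: DO_carrier_cases)
          case (rot a b \<phi>)
          have "\<not> b"
          proof
            assume b
            then have e: "w ^ a * cis \<phi> * z2 = z1" "inverse (w ^ a) * cis \<phi> * z1 = z2"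
              using gz rot by (simp_all add: rho_apply)
            have "z2 * z2 * (w ^ a * w ^ a) = z2 * (inverse (w ^ a) * cis \<phi> * z1) * (w ^ a * w ^ a)"
              using e(2) by simp
            also have "\<dots> = (w ^ a * cis \<phi> * z2) * z1" by (simp add: field_simps)
            finally show False using e(1) no' by simp
          qed
          then show ?thesis using gz rot by (simp add: rho_apply)
        next
          case (refl a b \<phi>)
          \<comment> \<open>With \<open>kappa\<close>, a reflection conjugates each coordinate
            separately; combined with equal moduli this gives the relation excluded by
            \<open>no'\<close>.\<close>
          have "\<not> b"
          proof
            assume b
            then have e: "w ^ a * cis \<phi> * cnj z1 = z1" "inverse (w ^ a) * cis \<phi> * cnj z2 = z2"
              using gz refl by (simp_all add: rho_apply)
            have N: "z1 * cnj z1 = z2 * cnj z2"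
              using norm_eq by (simp add: complex_norm_square[symmetric])
            have "z2 * z2 * (w ^ a * w ^ a) * cnj z1
                = z2 * (inverse (w ^ a) * cis \<phi> * cnj z2) * (w ^ a * w ^ a) * cnj z1"
              using e(2) by simp
            also have "\<dots> = (w ^ a * cis \<phi> * cnj z1) * (z2 * cnj z2)" by (simp add: field_simps)
            also have "\<dots> = z1 * z1 * cnj z1" using e(1) N by simp
            finally show False using nz no' by simp
          qed
          then have e: "w ^ a * cis \<phi> * cnj z2 = z1" "inverse (w ^ a) * cis \<phi> * cnj z1 = z2"
            using gz refl by (simp_all add: rho_apply)
          have "w ^ a * cis \<phi> * cnj (- \<i> * z2) = \<i> * (w ^ a * cis \<phi> * cnj z2)"
            "inverse (w ^ a) * cis \<phi> * cnj (\<i> * z1) = - \<i> * (inverse (w ^ a) * cis \<phi> * cnj z1)"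
            by simp_all
          then show ?thesis
            using \<open>\<not> b\<close> unfolding refl(2) rho_apply e by simp
        qed
      qed
      then show False using notin_i by (simp add: Fix_def)
    qed
    obtain c x where c: "z2 / z1 = w ^ (2 * c) * x" and x: "x = 1 \<or> x = q"
    proof -
      from * obtain c where "z2 / z1 = w ^ (2 * c) \<or> z2 / z1 = w ^ (2 * c) * q"
        using even_power_or_q by blast
      then show ?thesis using that[of c 1] that[of c q] by auto
    qed
    \<comment> \<open>The element \<open>zeta ^ c\<close> divides the ratio \<open>z2 / z1\<close>
      by \<open>w ^ (2 * c)\<close>, leaving \<open>x\<close>; the rotation then makes the first
      coordinate positive.\<close>
    define \<phi> where "\<phi> = - Arg (w ^ c * z1)"
    have 1: "w ^ c * cis \<phi> * z1 = of_real (norm z1)"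
      using rotate_to_norm[of "w ^ c * z1"]
      by (simp add: \<phi>_def norm_mult norm_power mult_ac)
    have "z2 = w ^ c * w ^ c * x * z1"
      using c nz by (simp add: divide_eq_eq mult_2 power_add)
    then have "inverse (w ^ c) * cis \<phi> * z2 = (w ^ c * cis \<phi> * z1) * x"
      by (simp add: field_simps)
    then have "rho n k ((c mod n, False), rot \<phi>) z = norm z1 *\<^sub>R (1, x)"
      using 1 by (simp add: z12 rho_apply scaleR_conv_of_real)
    moreover have "((c mod n, False), rot \<phi>) \<in> carrier (DO n)" by (simp del: carrier_DirProd)
    moreover have "norm z1 \<noteq> 0" "(1, x) \<in> {(1, 0), (1, 1), (1, q)}" using x nz by auto
    ultimately show ?thesis by blast
  qed
qed

lemma stab_axial:
  assumes "Fix (rho n k) (stab p) = span {p}" "p \<noteq> 0"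
  shows "stab p \<in> axial_isotropy (DO n) (rho n k)"
proof -
  have "dim (Fix (rho n k) (stab p)) = 1" using assms by simp
  then show ?thesis unfolding axial_isotropy_def by blast
qed

lemma rot_pi_carrier: "((0, False), rot pi) \<in> carrier (DO n)"
  by (simp del: carrier_DirProd)

lemma rho_rot_pi: "rho n k ((0, False), rot pi) z = - z"
  by (cases z) (simp add: rho_apply)

lemma axial_conjugate:
  assumes "H \<in> axial_isotropy (DO n) (rho n k)"
  shows "\<exists>K\<in>{stab (1, 0), stab (1, 1), stab (1, q)}. conjugate_subgroups (DO n) H K"
proof -
  obtain z where H: "H = stab z" and d: "dim (Fix (rho n k) (stab z)) = 1"
    using assms by (auto simp: axial_isotropy_def)
  have "z \<noteq> 0"
  proof
    \<comment> \<open>The stabilizer of 0 contains the rotation by \<pi>, which acts as -1, so its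
      fixed space would have dimension 0.\<close>
    assume "z = 0"
    then have pi: "((0, False), rot pi) \<in> stab z"
      using rot_pi_carrier by (simp add: mem_stab_iff rho_rot_pi del: carrier_DirProd)
    have "v = 0" if "v \<in> Fix (rho n k) (stab z)" for v
    proof -
      have "v = - v" using pi that rho_rot_pi[of v] by (auto simp: Fix_def)
      then have "2 *\<^sub>R v = 0" unfolding scaleR_2 by (simp only: eq_neg_iff_add_eq_0)
      then show ?thesis by simp
    qed
    then have "Fix (rho n k) (stab z) \<subseteq> {0}" by blast
    then show False using d by (metis dim_eq_0 zero_neq_one)
  qed
  moreover have "z \<in> Fix (rho n k) (stab z)" by (simp add: Fix_def mem_stab_iff)
  ultimately obtain g r p where g: "g \<in> carrier (DO n)" "r \<noteq> 0" "p \<in> {(1, 0), (1, 1), (1, q)}"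
      "rho n k g z = r *\<^sub>R p"
    using axial_orbit[OF dim_1_subset_span[OF d]] by blast
  then have "conjugate_subgroups (DO n) H (stab p)"
    using stabilizer_translate[OF g(1), of z] stab_scaleR[of r p]
    by (auto simp: conjugate_subgroups_def H simp del: carrier_DirProd)
  then show ?thesis using g(3) by blast
qed

section \<open>The rotation by \<pi> in the Weyl groups\<close>

text \<open>\<open>rot pi\<close> is minus the identity matrix. Being central, it lies in every
  normalizer.\<close>

lemma rot_pi_central:
  assumes "x \<in> carrier (DO n)"
  shows "((0, False), rot pi) \<otimes>\<^bsub>DO n\<^esub> x = x \<otimes>\<^bsub>DO n\<^esub> ((0, False), rot pi)"
proof -
  obtain a b A where x: "x = ((a, b), A)" by (metis surj_pair)
  have "rot pi ** A = A ** rot pi" by (simp add: mat2_eq_iff mat2_mult)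
  then show ?thesis using assms x by (cases b) auto
qed

lemma weyl_rot_pi:
  "stab p #>\<^bsub>DO n\<^esub> ((0, False), rot pi) \<in> carrier (weyl_group (DO n) (stab p))"
  using central_in_normalizer[OF stab_subgroup[of p] rot_pi_carrier rot_pi_central]
  unfolding weyl_group_def FactGroup_def RCOSETS_def r_coset_def by auto

text \<open>The sign does not depend on the representative \<open>g\<close> of the coset: the factor
  from \<open>stab p\<close> fixes \<open>z\<close> and, by linearity, also
  \<open>- z\<close>.\<close>

lemma weyl_rot_pi_action:
  assumes "g \<in> stab p #>\<^bsub>DO n\<^esub> ((0, False), rot pi)" "z \<in> Fix (rho n k) (stab p)"
  shows "rho n k g z = - z"
proof -
  obtain h where h: "h \<in> stab p" "g = h \<otimes>\<^bsub>DO n\<^esub> ((0, False), rot pi)"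
    using assms(1) by (auto simp: r_coset_def)
  then have "rho n k g z = rho n k h (- z)"
    using rot_pi_carrier by (simp add: rho_mult[OF n1] mem_stab_iff rho_rot_pi
        del: carrier_DirProd mult_DirProd)
  also have "\<dots> = - z" using assms(2) h(1) by (simp add: Fix_def linear_neg[OF rho_linear])
  finally show ?thesis .
qed

end

theorem proposition13:
  fixes n k h k' n' m :: nat
  assumes "n \<ge> 3"
    and "1 \<le> k" and "real k < real n / 2"
    and "h = gcd k n" and "k' = k div h" and "n' = n div h"
    and "[m * k' = 1] (mod n')"
  shows
    "(\<forall>r::real. r \<noteq> 0 \<longrightarrow>
        stabilizer (DO n) (rho n k) (complex_of_real r, 0) = T_grp n k \<and>
        stabilizer (DO n) (rho n k) (complex_of_real r, complex_of_real r) = S_grp n k m \<and>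
        (odd n' \<longrightarrow>
          stabilizer (DO n) (rho n k) (complex_of_real r, - complex_of_real r) = S'_grp n k m) \<and>
        (even n' \<longrightarrow>
          stabilizer (DO n) (rho n k)
            (complex_of_real r, complex_of_real r * exp (2 * pi * \<i> / n')) = S'_grp n k m)) \<and>
     {T_grp n k, S_grp n k m, S'_grp n k m} \<subseteq> axial_isotropy (DO n) (rho n k) \<and>
     \<not> conjugate_subgroups (DO n) (T_grp n k) (S_grp n k m) \<and>
     \<not> conjugate_subgroups (DO n) (T_grp n k) (S'_grp n k m) \<and>
     \<not> conjugate_subgroups (DO n) (S_grp n k m) (S'_grp n k m) \<and>
     (\<forall>H \<in> axial_isotropy (DO n) (rho n k).
        \<exists>K \<in> {T_grp n k, S_grp n k m, S'_grp n k m}. conjugate_subgroups (DO n) H K) \<and>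
     (\<forall>H \<in> {T_grp n k, S_grp n k m, S'_grp n k m}.
        H #>\<^bsub>DO n\<^esub> (\<one>\<^bsub>dihedral n\<^esub>, rot pi) \<in> carrier (weyl_group (DO n) H) \<and>
        (\<forall>g \<in> H #>\<^bsub>DO n\<^esub> (\<one>\<^bsub>dihedral n\<^esub>, rot pi). \<forall>z \<in> Fix (rho n k) H. rho n k g z = - z))"
proof -
  interpret ek_representation n k m
    using assms by unfold_locales auto
  have n': "n' = nb" using assms by (simp add: nb_def)
  \<comment> \<open>The listed points are real multiples of the three representatives, and nonzero
    real scaling does not change a stabilizer.\<close>
  have points: "(of_real r, 0) = r *\<^sub>R (1, 0)" "(of_real r, of_real r) = r *\<^sub>R (1, 1)"
    "odd n' \<Longrightarrow> (of_real r, - of_real r) = r *\<^sub>R (1, q)"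
    "even n' \<Longrightarrow> (of_real r, of_real r * exp (2 * pi * \<i> / n')) = r *\<^sub>R (1, q)" for r :: real
    by (simp_all add: scaleR_conv_of_real q_def n' cis_conv_exp mult_ac)
  note fixed = Fix_T Fix_S Fix_S'
  have not_T: "\<not> conjugate_subgroups (DO n) (stab (1, 0)) (stab (1, x))"
    if "x \<noteq> 0" "Fix (rho n k) (stab (1, x)) = span {(1, x)}" for x
    using stab_conjugateD[OF that(2)] T_not_conjugate[OF that(1)] by blast
  have not_S: "\<not> conjugate_subgroups (DO n) (stab (1, 1)) (stab (1, q))"
    using stab_conjugateD[OF Fix_S'] S_not_conjugate by blast
  have axial: "{stab (1, 0), stab (1, 1), stab (1, q)} \<subseteq> axial_isotropy (DO n) (rho n k)"
    using stab_axial fixed by (auto simp: zero_prod_def)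
  have stabs: "\<forall>r::real. r \<noteq> 0 \<longrightarrow>
      stab (of_real r, 0) = stab (1, 0) \<and> stab (of_real r, of_real r) = stab (1, 1) \<and>
      (odd n' \<longrightarrow> stab (of_real r, - of_real r) = stab (1, q)) \<and>
      (even n' \<longrightarrow> stab (of_real r, of_real r * exp (2 * pi * \<i> / n')) = stab (1, q))"
    using points stab_scaleR by metis
  have weyl: "\<forall>H\<in>{stab (1, 0), stab (1, 1), stab (1, q)}.
      H #>\<^bsub>DO n\<^esub> ((0, False), rot pi) \<in> carrier (weyl_group (DO n) H) \<and>
      (\<forall>g \<in> H #>\<^bsub>DO n\<^esub> ((0, False), rot pi). \<forall>z \<in> Fix (rho n k) H. rho n k g z = - z)"
    using weyl_rot_pi weyl_rot_pi_action by blast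
  show ?thesis
    unfolding stab_T[symmetric] stab_S[symmetric] stab_S'[symmetric] dihedral_simps(1)
    by (intro conjI stabs axial weyl not_S not_T[OF _ Fix_S] not_T[OF _ Fix_S'] ballI axial_conjugate)
      simp_all
qed

end
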